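(* Suppose we are given, for each $n\ge3$, coprime positive integers $q_1=q_{1,n}$, $q_2=q_{2,n}$ and nonempty sets $\Omega_{q_1}\subset\mathbb{Z}/q_1\mathbb{Z}$, $\Omega_{q_2}\subset\mathbb{Z}/q_2\mathbb{Z}$; let $q=q_1q_2$ and let $\Omega_q\subset\mathbb{Z}/q\mathbb{Z}$ be defined by $x\in\Omega_q$ iff $x\bmod q_1\in\Omega_{q_1}$ and $x\bmod q_2\in\Omega_{q_2}$. Suppose that the spacings of elements of $\Omega_{q_1}$ become strongly Poisson with parameter $s_{q_2}$ as $n\to\infty$, and that for every $k\ge2$ there is $C_k$ such that $$\sum_{\mathbf{h}\in H\cap\mathbb{Z}^{k-1}}\varepsilon_k(\mathbf{h},\Omega_{q_2})^2\le C_k\sum_{\mathbf{h}\in H\cap\mathbb{Z}^{k-1}}1$$ uniformly for all $H$ of the form $s_qX$ with $X\in\mathbb{B}_k$. Then the spacings of elements of $\Omega_q$ become Poisson as $n\to\infty$ if and only if the spacings of elements of $\Omega_{q_2}$ become Poisson with parameter $s_{q_1}$ as $n\to\infty$.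
   Context: For a positive integer $Q$ and nonempty $\Omega\subset\mathbb{Z}/Q\mathbb{Z}$, $s=Q/|\Omega|$ and $r=1/s$; $s_{q_1},s_{q_2},s_q$ are these quantities for $\Omega_{q_1},\Omega_{q_2},\Omega_q$. For $k\ge2$ and $\mathbf{h}=(h_1,\dots,h_{k-1})\in\mathbb{Z}^{k-1}$ with $h_0=0$, $N_k(\mathbf{h},\Omega)=\#\{t\bmod Q:\ t+h_i\in\Omega,\ 0\le i\le k-1\}$ and $\varepsilon_k(\mathbf{h},\Omega)$ is defined by $N_k(\mathbf{h},\Omega)=Q r^k(1+\varepsilon_k(\mathbf{h},\Omega))$. $\mathbb{B}_k$ is the set of boxes $B(b_1,\dots,b_{k-1})=\{x\in\mathbb{R}^{k-1}:\ 0<x_i-x_{i-1}\le b_i,\ i=1,\dots,k-1\}$ (with $x_0=0$, $b_i>0$). For a sequence of sets $\Omega_n\subset\mathbb{Z}/Q_n\mathbb{Z}$ with spacing $s_n$ and positive reals $\theta_n$: the spacings become Poisson with parameter $\theta_n$ if for every $k\ge2$ and $X\in\mathbb{B}_k$, with $H_n=\theta_ns_nX$, $\sum_{\mathbf{h}\in H_n\cap\mathbb{Z}^{k-1}}\varepsilon_k(\mathbf{h},\Omega_n)=o\bigl(\#(H_n\cap\mathbb{Z}^{k-1})\bigr)$ as $n\to\infty$; they become strongly Poisson with parameter $\theta_n$ if under the same conditions $\sum_{\mathbf{h}\in H_n\cap\mathbb{Z}^{k-1}}\varepsilon_k(\mathbf{h},\Omega_n)^2=o\bigl(\#(H_n\cap\mathbb{Z}^{k-1})\bigr)$.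 "Poisson" means Poisson with parameter $1$. *)

theory Defs
  imports Complex_Main "HOL-Library.Landau_Symbols"
begin

text \<open>
  A set of residue classes modulo Q is represented by its set of canonical representatives,
  a subset of {0..<int Q}; an integer x lies in it iff x mod int Q does.

  A vector indexed by 1, ..., k-1 is represented by a function on the naturals that vanishes
  outside {1..<k}. The conventions x 0 = 0 and h 0 = 0 are thereby built in, and dimensions
  can be quantified over.
\<close>

definition residue_subset :: "nat \<Rightarrow> int set \<Rightarrow> bool" where
  "residue_subset Q \<Omega> \<longleftrightarrow> \<Omega> \<noteq> {} \<and> \<Omega> \<subseteq> {0..<int Q}"

definition mean_spacing :: "nat \<Rightarrow> int set \<Rightarrow> real" where
  "mean_spacing Q \<Omega> = real Q / real (card \<Omega>)"

definition density :: "nat \<Rightarrow> int set \<Rightarrow> real" where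
  "density Q \<Omega> = 1 / mean_spacing Q \<Omega>"

definition tuple_count :: "nat \<Rightarrow> nat \<Rightarrow> int set \<Rightarrow> (nat \<Rightarrow> int) \<Rightarrow> nat" where
  "tuple_count k Q \<Omega> h = card {t \<in> {0..<int Q}. \<forall>i<k. (t + h i) mod int Q \<in> \<Omega>}"

text \<open>The solution of \<open>tuple_count k Q \<Omega> h = Q * density Q \<Omega> ^ k * (1 + eps k Q \<Omega> h)\<close>.\<close>

definition eps :: "nat \<Rightarrow> nat \<Rightarrow> int set \<Rightarrow> (nat \<Rightarrow> int) \<Rightarrow> real" where
  "eps k Q \<Omega> h = real (tuple_count k Q \<Omega> h) / (real Q * density Q \<Omega> ^ k) - 1"

definition gap_box :: "nat \<Rightarrow> (nat \<Rightarrow> real) \<Rightarrow> (nat \<Rightarrow> real) set" where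
  "gap_box k b = {x. (\<forall>i. i \<notin> {1..<k} \<longrightarrow> x i = 0) \<and>
                     (\<forall>i\<in>{1..<k}. 0 < x i - x (i - 1) \<and> x i - x (i - 1) \<le> b i)}"

definition gap_boxes :: "nat \<Rightarrow> (nat \<Rightarrow> real) set set" where
  "gap_boxes k = {gap_box k b | b. \<forall>i\<in>{1..<k}. 0 < b i}"

definition dilate :: "real \<Rightarrow> (nat \<Rightarrow> real) set \<Rightarrow> (nat \<Rightarrow> real) set" where
  "dilate c X = (\<lambda>x i. c * x i) ` X"

text \<open>For a dilated box this is a finite set, so that sums over it and its cardinality are
  the intended ones.\<close>

definition int_points :: "(nat \<Rightarrow> real) set \<Rightarrow> (nat \<Rightarrow> int) set" where
  "int_points H = {h. (\<lambda>i. real_of_int (h i)) \<in> H}"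

definition becomes_poisson :: "(nat \<Rightarrow> nat) \<Rightarrow> (nat \<Rightarrow> int set) \<Rightarrow> (nat \<Rightarrow> real) \<Rightarrow> bool" where
  "becomes_poisson Q \<Omega> \<theta> \<longleftrightarrow>
     (\<forall>k\<ge>2. \<forall>X\<in>gap_boxes k.
        (\<lambda>n. \<Sum>h\<in>int_points (dilate (\<theta> n * mean_spacing (Q n) (\<Omega> n)) X). eps k (Q n) (\<Omega> n) h)
        \<in> o(\<lambda>n. real (card (int_points (dilate (\<theta> n * mean_spacing (Q n) (\<Omega> n)) X)))))"

definition becomes_strongly_poisson ::
    "(nat \<Rightarrow> nat) \<Rightarrow> (nat \<Rightarrow> int set) \<Rightarrow> (nat \<Rightarrow> real) \<Rightarrow> bool" where
  "becomes_strongly_poisson Q \<Omega> \<theta> \<longleftrightarrow>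
     (\<forall>k\<ge>2. \<forall>X\<in>gap_boxes k.
        (\<lambda>n. \<Sum>h\<in>int_points (dilate (\<theta> n * mean_spacing (Q n) (\<Omega> n)) X). (eps k (Q n) (\<Omega> n) h)\<^sup>2)
        \<in> o(\<lambda>n. real (card (int_points (dilate (\<theta> n * mean_spacing (Q n) (\<Omega> n)) X)))))"

definition crt_set :: "nat \<Rightarrow> int set \<Rightarrow> nat \<Rightarrow> int set \<Rightarrow> int set" where
  "crt_set q1 \<Omega>1 q2 \<Omega>2 = {x \<in> {0..<int (q1 * q2)}. x mod int q1 \<in> \<Omega>1 \<and> x mod int q2 \<in> \<Omega>2}"

end

theory Submission
  imports Defs "HOL-Number_Theory.Cong" "HOL-Analysis.Convex"
begin

text \<open>By the Chinese remainder theorem tuple counts and densities are multiplicative, so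
  \<open>1 + \<epsilon>\<^sub>q = (1 + \<epsilon>\<^sub>1) * (1 + \<epsilon>\<^sub>2)\<close>, that is \<open>\<epsilon>\<^sub>q - \<epsilon>\<^sub>2 = \<epsilon>\<^sub>1 + \<epsilon>\<^sub>1 * \<epsilon>\<^sub>2\<close>. All three Poisson conditions involve
  the same dilated boxes, and by Cauchy-Schwarz the sum of \<open>\<epsilon>\<^sub>1 + \<epsilon>\<^sub>1 * \<epsilon>\<^sub>2\<close> over a box is small
  compared with its number of integer points.\<close>

text \<open>Chinese remainder theorem in counting form: \<open>x\<close> is determined by its two
  residues, and every pair of residues occurs. Arbitrary predicates are allowed so that the lemma
  serves both the size of \<open>crt_set\<close> and tuple counts.\<close>

lemma card_crt:
  fixes P R :: "int \<Rightarrow> bool"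
  assumes "a > 0" "b > 0" "coprime a b"
  shows "card {x \<in> {0..<int (a * b)}. P (x mod int a) \<and> R (x mod int b)} =
         card {x \<in> {0..<int a}. P x} * card {x \<in> {0..<int b}. R x}"
proof -
  define f :: "int \<Rightarrow> int \<times> int" where "f = (\<lambda>x. (x mod int a, x mod int b))"
  let ?S = "{x \<in> {0..<int (a * b)}. P (x mod int a) \<and> R (x mod int b)}"
  let ?T = "{x \<in> {0..<int a}. P x} \<times> {x \<in> {0..<int b}. R x}"
  have cop: "coprime (int a) (int b)"
    using assms by simp
  have inj: "inj_on f {0..<int (a * b)}"
  proof (rule inj_onI)
    fix x y assume x: "x \<in> {0..<int (a * b)}" and y: "y \<in> {0..<int (a * b)}" and "f x = f y"
    then have "[x = y] (mod int a)" "[x = y] (mod int b)"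
      by (auto simp: f_def cong_def)
    then have "[x = y] (mod int a * int b)"
      using coprime_cong_mult cop by blast
    then show "x = y"
      using x y by (simp add: cong_def)
  qed
  \<comment> \<open>Surjectivity by counting: the injective image has \<open>a * b\<close> elements
    and lies in a product of the same size.\<close>
  have "f ` {0..<int (a * b)} = {0..<int a} \<times> {0..<int b}"
  proof (rule card_subset_eq)
    show "card (f ` {0..<int (a * b)}) = card ({0..<int a} \<times> {0..<int b})"
      using inj by (simp add: card_image nat_mult_distrib card_cartesian_product)
  qed (use assms in \<open>auto simp: f_def\<close>)
  moreover have "f ` ?S = f ` {0..<int (a * b)} \<inter> {(u, v). P u \<and> R v}"
    by (auto simp: f_def)
  ultimately have image: "f ` ?S = ?T"
    by auto
  have "inj_on f ?S"
    using inj by (rule inj_on_subset) auto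
  then have "card ?S = card (f ` ?S)"
    by (rule card_image[symmetric])
  also have "\<dots> = card {x \<in> {0..<int a}. P x} * card {x \<in> {0..<int b}. R x}"
    unfolding image by (rule card_cartesian_product)
  finally show ?thesis .
qed

lemma mean_spacing_crt_set:
  assumes "a > 0" "b > 0" "coprime a b" "residue_subset a A" "residue_subset b B"
  shows "mean_spacing (a * b) (crt_set a A b B) = mean_spacing a A * mean_spacing b B"
proof -
  have "{x \<in> {0..<int a}. x \<in> A} = A" "{x \<in> {0..<int b}. x \<in> B} = B"
    using assms by (auto simp: residue_subset_def)
  then show ?thesis
    using card_crt[OF assms(1-3), of "\<lambda>x. x \<in> A" "\<lambda>x. x \<in> B"]
    by (simp add: mean_spacing_def crt_set_def)
qed

text \<open>The residue of \<open>t + h i\<close> modulo \<open>a\<close> depends on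
  \<open>t\<close> only through \<open>t mod int a\<close>, and likewise for \<open>b\<close>, so
  the condition on \<open>t\<close> splits into one for each modulus and \<open>card_crt\<close>
  applies.\<close>

lemma tuple_count_crt_set:
  assumes "a > 0" "b > 0" "coprime a b"
  shows "tuple_count k (a * b) (crt_set a A b B) h = tuple_count k a A h * tuple_count k b B h"
proof -
  have "(t + h i) mod int (a * b) \<in> crt_set a A b B \<longleftrightarrow>
      (t mod int a + h i) mod int a \<in> A \<and> (t mod int b + h i) mod int b \<in> B" for t i
  proof -
    have "(t + h i) mod int (a * b) \<in> {0..<int (a * b)}"
      using assms by simp
    moreover have "(t + h i) mod int (a * b) mod int c = (t mod int c + h i) mod int c"
      if "c dvd a * b" for c
      using that by (simp only: mod_mod_cancel of_nat_dvd_iff mod_add_left_eq)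
    ultimately show ?thesis
      by (simp only: crt_set_def mem_Collect_eq dvd_triv_left dvd_triv_right simp_thms)
  qed
  then have "tuple_count k (a * b) (crt_set a A b B) h = card {t \<in> {0..<int (a * b)}.
      (\<forall>i<k. (t mod int a + h i) mod int a \<in> A) \<and> (\<forall>i<k. (t mod int b + h i) mod int b \<in> B)}"
    unfolding tuple_count_def by (intro arg_cong[where f = card]) auto
  also have "\<dots> = tuple_count k a A h * tuple_count k b B h"
    unfolding tuple_count_def by (rule card_crt[OF assms])
  finally show ?thesis .
qed

text \<open>The bracket isolates what has to be negligible when \<open>eps\<close> for
  \<open>a * b\<close> is replaced by \<open>eps\<close> for \<open>b\<close>.\<close>

lemma eps_crt_set:
  assumes "a > 0" "b > 0" "coprime a b" "residue_subset a A" "residue_subset b B"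
  shows "eps k (a * b) (crt_set a A b B) h =
         eps k b B h + (eps k a A h + eps k a A h * eps k b B h)"
proof -
  have "1 + eps k (a * b) (crt_set a A b B) h = (1 + eps k a A h) * (1 + eps k b B h)"
    by (simp only: eps_def density_def mean_spacing_crt_set[OF assms]
        tuple_count_crt_set[OF assms(1-3)]) (simp add: power_mult_distrib power_divide)
  then show ?thesis
    by (simp add: algebra_simps)
qed

lemma abs_sum_mult_le_of_sum_squares:
  fixes f g :: "'a \<Rightarrow> real"
  assumes f: "(\<Sum>x\<in>S. (f x)\<^sup>2) \<le> \<delta> * M" and g: "(\<Sum>x\<in>S. (g x)\<^sup>2) \<le> C * M"
    and "M \<ge> 0" "\<delta> * C \<le> e\<^sup>2" "e \<ge> 0" "\<delta> \<ge> 0"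
  shows "\<bar>\<Sum>x\<in>S. f x * g x\<bar> \<le> e * M"
proof -
  have "(\<Sum>x\<in>S. f x * g x)\<^sup>2 \<le> (\<Sum>x\<in>S. (f x)\<^sup>2) * (\<Sum>x\<in>S. (g x)\<^sup>2)"
    by (rule Cauchy_Schwarz_ineq_sum)
  also have "\<dots> \<le> (\<delta> * M) * (C * M)"
    using f g assms(3,6) by (intro mult_mono) (auto intro: sum_nonneg)
  also have "\<dots> = (\<delta> * C) * M\<^sup>2"
    by (simp add: power2_eq_square)
  also have "\<dots> \<le> (e * M)\<^sup>2"
    using assms(4) by (simp add: power_mult_distrib mult_right_mono)
  finally show ?thesis
    using assms by (simp add: abs_le_square_iff[symmetric] abs_mult)
qed

text \<open>Cauchy-Schwarz in asymptotic form: a small mean square times a bounded mean square gives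
  a small mean product. It covers both error terms, with \<open>g\<close> equal to 1 and to the
  second \<open>eps\<close>.\<close>

lemma smallo_sum_mult:
  fixes f g :: "nat \<Rightarrow> 'a \<Rightarrow> real" and M :: "nat \<Rightarrow> real"
  assumes f: "(\<lambda>n. \<Sum>x\<in>S n. (f n x)\<^sup>2) \<in> o(M)"
    and g: "\<forall>\<^sub>F n in sequentially. (\<Sum>x\<in>S n. (g n x)\<^sup>2) \<le> C * M n"
    and M: "\<And>n. M n \<ge> 0"
  shows "(\<lambda>n. \<Sum>x\<in>S n. f n x * g n x) \<in> o(M)"
proof (rule landau_o.smallI)
  fix e :: real assume e: "e > 0"
  \<comment> \<open>Cauchy-Schwarz bounds the squared sum by
    \<open>\<delta> * C * (M n)\<^sup>2\<close>, so \<open>\<delta> * C\<close> must not exceed the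
    square of \<open>e\<close>. The denominator is positive even if \<open>C\<close> is zero or
    negative.\<close>
  define \<delta> where "\<delta> = e\<^sup>2 / (\<bar>C\<bar> + 1)"
  have \<delta>: "\<delta> > 0"
    using e by (simp add: \<delta>_def)
  have "\<delta> * C \<le> \<delta> * (\<bar>C\<bar> + 1)"
    using \<delta> by (intro mult_left_mono) auto
  also have "\<dots> = e\<^sup>2"
    unfolding \<delta>_def by simp
  finally have \<delta>C: "\<delta> * C \<le> e\<^sup>2" .
  show "\<forall>\<^sub>F n in sequentially. norm (\<Sum>x\<in>S n. f n x * g n x) \<le> e * norm (M n)"
    using landau_o.smallD[OF f \<delta>] g
  proof eventually_elim
    case (elim n)
    have "(\<Sum>x\<in>S n. (f n x)\<^sup>2) \<le> \<delta> * M n"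
      using elim(1) M[of n] by simp
    then have "\<bar>\<Sum>x\<in>S n. f n x * g n x\<bar> \<le> e * M n"
      using elim(2) M \<delta>C e \<delta> by (intro abs_sum_mult_le_of_sum_squares) auto
    then show ?case
      using M[of n] by simp
  qed
qed

text \<open>Little-o classes are closed under sums and differences, so a negligible term can be
  added or removed.\<close>

lemma smallo_add_cancel_iff:
  assumes "\<forall>\<^sub>F x in F. f x = g x + h x" "h \<in> o[F](M)"
  shows "f \<in> o[F](M) \<longleftrightarrow> g \<in> o[F](M)"
proof -
  have "f \<in> o[F](M) \<longleftrightarrow> (\<lambda>x. g x + h x) \<in> o[F](M)"
    using assms(1) by (rule landau_o.small.in_cong)
  also have "\<dots> \<longleftrightarrow> g \<in> o[F](M)"
    using sum_in_smallo(1)[OF _ assms(2), of g] sum_in_smallo(2)[OF _ assms(2), of "\<lambda>x. g x + h x"]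
    by auto
  finally show ?thesis .
qed

theorem theorem5p1:
  fixes q1 q2 q :: "nat \<Rightarrow> nat" and \<Omega>1 \<Omega>2 \<Omega> :: "nat \<Rightarrow> int set"
  assumes "\<And>n. n \<ge> 3 \<Longrightarrow> q1 n > 0 \<and> q2 n > 0 \<and> coprime (q1 n) (q2 n)"
    and "\<And>n. n \<ge> 3 \<Longrightarrow> residue_subset (q1 n) (\<Omega>1 n)"
    and "\<And>n. n \<ge> 3 \<Longrightarrow> residue_subset (q2 n) (\<Omega>2 n)"
    and "\<And>n. n \<ge> 3 \<Longrightarrow> q n = q1 n * q2 n"
    and "\<And>n. n \<ge> 3 \<Longrightarrow> \<Omega> n = crt_set (q1 n) (\<Omega>1 n) (q2 n) (\<Omega>2 n)"
    and "becomes_strongly_poisson q1 \<Omega>1 (\<lambda>n. mean_spacing (q2 n) (\<Omega>2 n))"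
    and "\<And>k. k \<ge> 2 \<Longrightarrow> \<exists>C. \<forall>n\<ge>3. \<forall>X\<in>gap_boxes k.
           (\<Sum>h\<in>int_points (dilate (mean_spacing (q n) (\<Omega> n)) X). (eps k (q2 n) (\<Omega>2 n) h)\<^sup>2)
           \<le> C * (\<Sum>h\<in>int_points (dilate (mean_spacing (q n) (\<Omega> n)) X). 1)"
  shows "becomes_poisson q \<Omega> (\<lambda>n. 1) \<longleftrightarrow>
         becomes_poisson q2 \<Omega>2 (\<lambda>n. mean_spacing (q1 n) (\<Omega>1 n))"
proof -
  \<comment> \<open>The common box of all three conditions: parameter times spacing is always the
    product of the two spacings, at least for \<open>n \<ge> 3\<close>.\<close>
  define H where "H = (\<lambda>X n.
    int_points (dilate (mean_spacing (q1 n) (\<Omega>1 n) * mean_spacing (q2 n) (\<Omega>2 n)) X))"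
  have spacing: "mean_spacing (q n) (\<Omega> n) = mean_spacing (q1 n) (\<Omega>1 n) * mean_spacing (q2 n) (\<Omega>2 n)"
    if "n \<ge> 3" for n
    using assms(1-5)[OF that] by (simp add: mean_spacing_crt_set)
  have H_eq: "int_points (dilate (mean_spacing (q n) (\<Omega> n)) X) = H X n" if "n \<ge> 3" for n X
    by (simp add: spacing[OF that] H_def)
  have "(\<lambda>n. \<Sum>h\<in>int_points (dilate (1 * mean_spacing (q n) (\<Omega> n)) X). eps k (q n) (\<Omega> n) h)
        \<in> o(\<lambda>n. real (card (int_points (dilate (1 * mean_spacing (q n) (\<Omega> n)) X)))) \<longleftrightarrow>
      (\<lambda>n. \<Sum>h\<in>H X n. eps k (q2 n) (\<Omega>2 n) h) \<in> o(\<lambda>n. real (card (H X n)))"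
    (is "?L \<in> o(?cL) \<longleftrightarrow> ?R \<in> o(?M)") if k: "k \<ge> 2" and X: "X \<in> gap_boxes k" for k X
  proof -
    let ?e1 = "\<lambda>n h. eps k (q1 n) (\<Omega>1 n) h" and ?e2 = "\<lambda>n h. eps k (q2 n) (\<Omega>2 n) h"
    have strong: "(\<lambda>n. \<Sum>h\<in>H X n. (?e1 n h)\<^sup>2) \<in> o(?M)"
      using assms(6) k X unfolding becomes_strongly_poisson_def H_def by (simp add: mult.commute)
    obtain C where "\<forall>n\<ge>3. \<forall>X\<in>gap_boxes k.
           (\<Sum>h\<in>int_points (dilate (mean_spacing (q n) (\<Omega> n)) X). (?e2 n h)\<^sup>2)
           \<le> C * (\<Sum>h\<in>int_points (dilate (mean_spacing (q n) (\<Omega> n)) X). 1)"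
      using assms(7)[OF k] by blast
    \<comment> \<open>The sum of ones in the hypothesis is the number of integer points, and
      uniformity in \<open>n\<close> lets a single \<open>C\<close> serve all
      \<open>n \<ge> 3\<close>.\<close>
    then have bounded: "\<forall>\<^sub>F n in sequentially. (\<Sum>h\<in>H X n. (?e2 n h)\<^sup>2) \<le> C * ?M n"
      using X by (auto simp: eventually_sequentially H_eq intro!: exI[of _ 3])
    \<comment> \<open>The linear term is a product with the constant 1, whose squares sum to the
      number of points, hence \<open>C = 1\<close>.\<close>
    have "(\<lambda>n. \<Sum>h\<in>H X n. ?e1 n h * 1) \<in> o(?M)"
      using strong by (rule smallo_sum_mult[where C = 1]) auto
    moreover have "(\<lambda>n. \<Sum>h\<in>H X n. ?e1 n h * ?e2 n h) \<in> o(?M)"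
      using strong bounded by (rule smallo_sum_mult) auto
    ultimately have error: "(\<lambda>n. (\<Sum>h\<in>H X n. ?e1 n h) + (\<Sum>h\<in>H X n. ?e1 n h * ?e2 n h)) \<in> o(?M)"
      by (simp add: sum_in_smallo)
    have "\<forall>\<^sub>F n in sequentially. ?L n =
        ?R n + ((\<Sum>h\<in>H X n. ?e1 n h) + (\<Sum>h\<in>H X n. ?e1 n h * ?e2 n h))"
      using eventually_ge_at_top[of 3]
    proof eventually_elim
      case (elim n)
      have "eps k (q n) (\<Omega> n) h = ?e2 n h + (?e1 n h + ?e1 n h * ?e2 n h)" for h
        using assms(1-5)[OF elim] by (simp add: eps_crt_set)
      then show ?case
        using H_eq[OF elim] by (simp add: sum.distrib)
    qed
    then have "?L \<in> o(?M) \<longleftrightarrow> ?R \<in> o(?M)"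
      using error by (rule smallo_add_cancel_iff)
    \<comment> \<open>The comparison function must be exchanged as well, since the two boxes are
      known to agree only from 3 on.\<close>
    moreover have "\<forall>\<^sub>F n in sequentially. ?cL n = ?M n"
      using eventually_ge_at_top[of 3] by eventually_elim (simp add: H_eq)
    then have "o(?cL) = o(?M)"
      by (rule landau_o.small.cong)
    ultimately show ?thesis
      by simp
  qed
  then show ?thesis
    unfolding becomes_poisson_def H_def by simp
qed

end
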